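(* Let $\eta\in\mathbb{R}$ (possibly $\eta=0$) and let $V^{\eta}_t=B_t+\eta t$, $t\ge 0$, be a Brownian motion with drift $\eta$, where $(B_t)_{t\ge 0}$ is a standard one-dimensional Brownian motion. Then, almost surely, $$\frac{R_t(V^{\eta})}{t}\longrightarrow |\eta|\quad\text{as } t\to\infty.$$
   Context: For a real-valued process $X=(X_t)_{t\ge 0}$, the range up to time $t$ is $R_t(X)=\sup_{0\le s\le t}X_s-\inf_{0\le s\le t}X_s$. *)

theory Defs
  imports "HOL-Probability.Probability"
begin

text \<open>Processes are indexed by \<open>real\<close>; only times \<open>t \<ge> 0\<close> are constrained or used.
  The initial value and path continuity are required only almost surely. Increments over
  \<open>{t 0, \<dots>, t n}\<close> are the \<open>n\<close> differences \<open>B (t (i+1)) - B (t i)\<close> for \<open>i < n\<close>.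
  The second argument of \<^const>\<open>normal_density\<close> is the standard deviation.\<close>

locale standard_brownian_motion = prob_space M
  for M :: "'a measure" +
  fixes B :: "real \<Rightarrow> 'a \<Rightarrow> real"
  assumes measurable_B: "\<And>t. 0 \<le> t \<Longrightarrow> random_variable borel (B t)"
    and start_at_zero: "AE \<omega> in M. B 0 \<omega> = 0"
    and indep_increments:
      "\<And>(t :: nat \<Rightarrow> real) n. 0 \<le> t 0 \<Longrightarrow> strict_mono_on {..n} t \<Longrightarrow>
         indep_vars (\<lambda>_. borel) (\<lambda>i \<omega>. B (t (Suc i)) \<omega> - B (t i) \<omega>) {..<n}"
    and normal_increments:
      "\<And>s t. 0 \<le> s \<Longrightarrow> s < t \<Longrightarrow>
         distributed M lborel (\<lambda>\<omega>. B t \<omega> - B s \<omega>) (normal_density 0 (sqrt (t - s)))"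
    and continuous_paths: "AE \<omega> in M. continuous_on {0..} (\<lambda>t. B t \<omega>)"

definition with_drift :: "(real \<Rightarrow> 'a \<Rightarrow> real) \<Rightarrow> real \<Rightarrow> real \<Rightarrow> 'a \<Rightarrow> real" where
  "with_drift B \<eta> t \<omega> = B t \<omega> + \<eta> * t"

text \<open>The supremum and infimum are those of \<open>real\<close>, hence meaningful when the path is bounded on
  \<open>{0..t}\<close>, in particular when it is continuous there.\<close>

definition process_range :: "(real \<Rightarrow> 'a \<Rightarrow> real) \<Rightarrow> real \<Rightarrow> 'a \<Rightarrow> real" where
  "process_range X t \<omega> = (SUP s\<in>{0..t}. X s \<omega>) - (INF s\<in>{0..t}. X s \<omega>)"

end

theory Submission
  imports Defs
begin

text \<open>
  The drift alone has range exactly \<open>\<bar>\<eta>\<bar> * t\<close> up to time \<open>t\<close>, and a perturbation that stays below \<open>d\<close>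
  on \<open>{0..t}\<close> changes a range by at most \<open>2 * d\<close> (lemma \<open>process_range_near_linear\<close>).  So it
  is enough that, almost surely, \<open>\<bar>B s\<bar>\<close> is of smaller order than \<open>t\<close> uniformly for \<open>s \<le> t\<close>.  It suffices to have this along the times \<open>t = 2 ^ m\<close>, because every large \<open>t\<close>
  lies within a factor \<open>2\<close> below such a time.

  For the uniform estimate on \<open>{0..T}\<close> chain along the dyadic subdivisions.  Every point of
  the \<open>k\<close>-th dyadic grid of \<open>{0..T}\<close> is reached from \<open>0\<close> by at most one increment of each of the levels \<open>0, \<dots>, k\<close>, so if all increments of level \<open>k\<close> are at most
  \<open>e * r ^ k * T\<close>, then the path is bounded by \<open>e * T / (1 - r)\<close> on \<open>{0..T}\<close>
  (lemma \<open>chaining_bound\<close>).  A level-\<open>k\<close> increment is normal with variance \<open>T / 2 ^ k\<close>, and its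
  fourth moment bounds the probability that one of the \<open>2 ^ k\<close> increments of this level is too
  large by
  \<open>2 ^ k * 3 * (T / 2 ^ k)\<^sup>2 / (e * r ^ k * T) ^ 4 = 3 / (e ^ 4 * T\<^sup>2) * (1 / (2 * r ^ 4)) ^ k\<close>.
  For \<open>r = 7 / 8\<close> we have both \<open>r < 1\<close> and \<open>2 * r ^ 4 > 1\<close>, so this is summable over \<open>k\<close>, and the sum
  is summable over \<open>T = 2 ^ m\<close>.  The Borel-Cantelli lemma concludes.
\<close>

section \<open>Chaining along dyadic grids\<close>

text \<open>A grid point of level \<open>Suc k\<close> either belongs to level \<open>k\<close> or is the right neighbour of a point
  that does; so each level costs one increment.\<close>

lemma dyadic_grid_bound:
  fixes f :: "real \<Rightarrow> real"
  assumes zero: "f 0 = 0"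
    and incr: "\<And>k j. j < 2 ^ k \<Longrightarrow>
      \<bar>f (real (Suc j) * T / 2 ^ k) - f (real j * T / 2 ^ k)\<bar> \<le> a k"
    and j: "j \<le> 2 ^ k"
  shows "\<bar>f (real j * T / 2 ^ k)\<bar> \<le> (\<Sum>i\<le>k. a i)"
  using j
proof (induction k arbitrary: j)
  case 0
  have "0 \<le> a 0" using incr[of 0 0] by simp
  moreover have "j = 0 \<or> j = 1" using 0 by auto
  ultimately show ?case using incr[of 0 0] zero by auto
next
  case (Suc k)
  have a_nonneg: "0 \<le> a (Suc k)" using incr[of 0 "Suc k"] by simp
  show ?case
  proof (cases "even j")
    case True
    then obtain i where i: "j = 2 * i" by (elim evenE)
    have "\<bar>f (real i * T / 2 ^ k)\<bar> \<le> (\<Sum>i\<le>k. a i)"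
      using Suc.prems i by (intro Suc.IH) simp
    moreover have "real j * T / 2 ^ Suc k = real i * T / 2 ^ k" by (simp add: i)
    ultimately show ?thesis using a_nonneg by simp
  next
    case False
    then obtain i where i: "j = Suc (2 * i)" by (elim oddE) simp
    have lt: "2 * i < 2 ^ Suc k" using Suc.prems i by simp
    then have "\<bar>f (real i * T / 2 ^ k)\<bar> \<le> (\<Sum>i\<le>k. a i)"
      by (intro Suc.IH) simp
    moreover have "real (2 * i) * T / 2 ^ Suc k = real i * T / 2 ^ k" by simp
    ultimately have "\<bar>f (real (2 * i) * T / 2 ^ Suc k)\<bar> \<le> (\<Sum>i\<le>k. a i)" by metis
    then show ?thesis using incr[OF lt] unfolding i by simp
  qed
qed

text \<open>Rounding \<open>s\<close> down to the grid of level \<open>k\<close> gives points that converge to \<open>s\<close>, so by continuity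
  the bound on the grids carries over to \<open>s\<close>.\<close>

lemma chaining_bound:
  fixes f :: "real \<Rightarrow> real"
  assumes T: "0 < T" and zero: "f 0 = 0" and cont: "continuous_on {0..T} f"
    and incr: "\<And>k j. j < 2 ^ k \<Longrightarrow>
      \<bar>f (real (Suc j) * T / 2 ^ k) - f (real j * T / 2 ^ k)\<bar> \<le> a k"
    and sum: "\<And>k. (\<Sum>i\<le>k. a i) \<le> C"
    and s: "s \<in> {0..T}"
  shows "\<bar>f s\<bar> \<le> C"
proof -
  define n where "n k = nat \<lfloor>s / T * 2 ^ k\<rfloor>" for k
  define x where "x k = real (n k) * T / 2 ^ k" for k
  have n_eq: "real (n k) = of_int \<lfloor>s / T * 2 ^ k\<rfloor>" for k
    using s T by (simp add: n_def)
  have n_le: "real (n k) \<le> s / T * 2 ^ k" for k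
    unfolding n_eq by simp
  have n_gt: "s / T * 2 ^ k - 1 < real (n k)" for k
    unfolding n_eq by linarith
  have x_le: "x k \<le> s" for k
    using n_le[of k] T by (simp add: x_def field_simps)
  have x_ge: "s - T * (1 / 2) ^ k \<le> x k" for k
  proof -
    have "(s / T * 2 ^ k - 1) * (T / 2 ^ k) \<le> real (n k) * (T / 2 ^ k)"
      using n_gt[of k] T by (intro mult_right_mono) auto
    moreover have "(s / T * 2 ^ k - 1) * (T / 2 ^ k) = s - T * (1 / 2) ^ k"
      using T by (simp add: left_diff_distrib diff_divide_distrib power_one_over)
    ultimately show ?thesis by (simp add: x_def)
  qed
  have n_bound: "n k \<le> 2 ^ k" for k
  proof -
    have "s / T * 2 ^ k \<le> 1 * 2 ^ k"
      using s T by (intro mult_right_mono) auto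
    then have "real (n k) \<le> 1 * 2 ^ k" by (rule order_trans[OF n_le])
    then show ?thesis by simp
  qed
  have x_in: "x k \<in> {0..T}" for k
    using x_le[of k] s T by (simp add: x_def)
  have "(\<lambda>k. s - T * (1 / 2) ^ k) \<longlonglongrightarrow> s - T * 0"
    by (intro tendsto_intros LIMSEQ_power_zero) simp
  then have x_lim: "x \<longlonglongrightarrow> s"
    using x_le x_ge by (intro tendsto_sandwich[of "\<lambda>k. s - T * (1 / 2) ^ k" x _ "\<lambda>_. s"]) auto
  have "(\<lambda>k. f (x k)) \<longlonglongrightarrow> f s"
    using cont x_lim s x_in by (intro continuous_on_tendsto_compose[OF cont]) auto
  then have "(\<lambda>k. \<bar>f (x k)\<bar>) \<longlonglongrightarrow> \<bar>f s\<bar>"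
    by (rule tendsto_rabs)
  moreover have "\<bar>f (x k)\<bar> \<le> C" for k
    using dyadic_grid_bound[OF zero incr n_bound[of k]] sum[of k] unfolding x_def by linarith
  ultimately show ?thesis
    by (intro LIMSEQ_le_const2) auto
qed

section \<open>Dyadic increments of Brownian motion\<close>

text \<open>Markov's inequality for the fourth power.  The second moment would be too weak for the chaining:
  the variances of the \<open>2 ^ k\<close> increments of level \<open>k\<close> add up to the same value for every \<open>k\<close>.\<close>

lemma (in prob_space) normal_tail_fourth_moment:
  assumes X: "distributed M lborel X (normal_density 0 \<sigma>)" and \<sigma>: "0 < \<sigma>" and a: "0 < a"
  shows "prob {\<omega> \<in> space M. a \<le> \<bar>X \<omega>\<bar>} \<le> 3 * \<sigma> ^ 4 / a ^ 4"
proof -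
  have int: "integrable M (\<lambda>\<omega>. X \<omega> ^ 4)"
    using distributed_integrable[OF X, of "\<lambda>x. x ^ 4"] integrable_normal_moment[OF \<sigma>, of 0 4]
    by simp
  have "expectation (\<lambda>\<omega>. X \<omega> ^ 4) = (\<integral>x. normal_density 0 \<sigma> x * x ^ 4 \<partial>lborel)"
    using distributed_integral[OF X, of "\<lambda>x. x ^ 4"] by simp
  also have "\<dots> = 3 * \<sigma> ^ 4"
    using integral_normal_moment_even[OF \<sigma>, of 0 2] \<sigma>
    by (simp add: fact_numeral field_simps flip: power_mult)
  finally have E: "expectation (\<lambda>\<omega>. X \<omega> ^ 4) = 3 * \<sigma> ^ 4" .
  have "a \<le> \<bar>x\<bar> \<longleftrightarrow> a ^ 4 \<le> x ^ 4" for x :: real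
  proof -
    have "a \<le> \<bar>x\<bar> \<longleftrightarrow> a ^ 4 \<le> \<bar>x\<bar> ^ 4" using a by (intro power_mono_iff[symmetric]) auto
    then show ?thesis by simp
  qed
  then have "prob {\<omega> \<in> space M. a \<le> \<bar>X \<omega>\<bar>} = prob {\<omega> \<in> space M. a ^ 4 \<le> X \<omega> ^ 4}" by simp
  also have "\<dots> \<le> expectation (\<lambda>\<omega>. X \<omega> ^ 4) / a ^ 4"
    using int a by (intro integral_Markov_inequality_measure[where A = "{}"]) auto
  finally show ?thesis by (simp add: E)
qed

definition large_dyadic_increment :: "'a measure \<Rightarrow> (real \<Rightarrow> 'a \<Rightarrow> real) \<Rightarrow> real \<Rightarrow> real \<Rightarrow> 'a set" where
  "large_dyadic_increment M B e T = (\<Union>k. \<Union>j<2 ^ k. {\<omega> \<in> space M.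
     e * (7 / 8) ^ k * T \<le> \<bar>B (real (Suc j) * T / 2 ^ k) \<omega> - B (real j * T / 2 ^ k) \<omega>\<bar>})"

context standard_brownian_motion
begin

lemma large_dyadic_increment_sets [measurable]:
  assumes "0 < T"
  shows "large_dyadic_increment M B e T \<in> sets M"
proof -
  have [measurable]: "B (real j * T / 2 ^ k) \<in> borel_measurable M" for j k
    using assms by (intro measurable_B) simp
  show ?thesis unfolding large_dyadic_increment_def by measurable
qed

text \<open>The union bound over all increments of all levels.  The ratio \<open>2048 / 2401\<close> is
  \<open>1 / (2 * (7 / 8) ^ 4)\<close>, whose being below \<open>1\<close> is what makes the levels summable; \<open>2401 / 353\<close> is
  the sum of the geometric series with this ratio.\<close>

lemma prob_large_dyadic_increment:
  assumes T: "0 < T" and e: "0 < e"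
  shows "prob (large_dyadic_increment M B e T) \<le> 3 / (e ^ 4 * T\<^sup>2) * (2401 / 353)"
proof -
  define E where "E k j = {\<omega> \<in> space M.
     e * (7 / 8) ^ k * T \<le> \<bar>B (real (Suc j) * T / 2 ^ k) \<omega> - B (real j * T / 2 ^ k) \<omega>\<bar>}"
    for k j :: nat
  define c where "c k = 3 / (e ^ 4 * T\<^sup>2) * (2048 / 2401 :: real) ^ k" for k :: nat
  have [measurable]: "B (real j * T / 2 ^ k) \<in> borel_measurable M" for j k
    using T by (intro measurable_B) simp
  have E_sets [measurable]: "E k j \<in> sets M" for k j
    unfolding E_def by measurable
  have E_prob: "prob (E k j) \<le> 3 * (T / 2 ^ k)\<^sup>2 / (e * (7 / 8) ^ k * T) ^ 4" for k j
  proof -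
    have diff: "real (Suc j) * T / 2 ^ k - real j * T / 2 ^ k = T / 2 ^ k"
      by (simp add: field_simps)
    have pos: "0 < T / 2 ^ k" using T by simp
    have "real j * T / 2 ^ k < real (Suc j) * T / 2 ^ k"
      using diff pos by linarith
    then have "distributed M lborel
        (\<lambda>\<omega>. B (real (Suc j) * T / 2 ^ k) \<omega> - B (real j * T / 2 ^ k) \<omega>)
        (normal_density 0 (sqrt (T / 2 ^ k)))"
      using normal_increments[of "real j * T / 2 ^ k" "real (Suc j) * T / 2 ^ k"] T
      unfolding diff by simp
    from normal_tail_fourth_moment[OF this, of "e * (7 / 8) ^ k * T"]
    have "prob (E k j) \<le> 3 * sqrt (T / 2 ^ k) ^ 4 / (e * (7 / 8) ^ k * T) ^ 4"
      using T e pos unfolding E_def by simp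
    also have "sqrt (T / 2 ^ k) ^ 4 = (T / 2 ^ k)\<^sup>2"
    proof -
      have "sqrt (T / 2 ^ k) ^ 4 = ((sqrt (T / 2 ^ k))\<^sup>2)\<^sup>2"
        by (simp only: power_mult[symmetric]) simp
      then show ?thesis using pos by simp
    qed
    finally show ?thesis .
  qed
  have level: "prob (\<Union>j<2 ^ k. E k j) \<le> c k" for k
  proof -
    have "prob (\<Union>j<2 ^ k. E k j) \<le> (\<Sum>j<2 ^ k. prob (E k j))"
      by (intro finite_measure_subadditive_finite) auto
    also have "\<dots> \<le> (\<Sum>j<(2 :: nat) ^ k. 3 * (T / 2 ^ k)\<^sup>2 / (e * (7 / 8) ^ k * T) ^ 4)"
      by (intro sum_mono E_prob)
    also have "\<dots> = 2 ^ k * (3 * (T / 2 ^ k)\<^sup>2 / (e * (7 / 8) ^ k * T) ^ 4)"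
      by simp
    also have "\<dots> = c k"
    proof -
      have "v * (3 * (T / v)\<^sup>2 / (e * u * T) ^ 4) = 3 / (e ^ 4 * T\<^sup>2) * (1 / (v * u ^ 4))"
        if "0 < u" "0 < v" for u v :: real
        using that T e by (simp add: field_simps power2_eq_square power4_eq_xxxx)
      moreover have "1 / (2 ^ k * ((7 / 8 :: real) ^ k) ^ 4) = (2048 / 2401) ^ k"
      proof -
        have "((7 / 8 :: real) ^ k) ^ 4 = ((7 / 8) ^ 4) ^ k"
          by (simp only: power_mult[symmetric] mult.commute)
        then have "2 ^ k * ((7 / 8 :: real) ^ k) ^ 4 = (2 * (7 / 8) ^ 4) ^ k"
          by (simp only: power_mult_distrib)
        then show ?thesis by (simp add: power_one_over[symmetric] power4_eq_xxxx)
      qed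
      ultimately show ?thesis
        unfolding c_def by (metis zero_less_power zero_less_numeral zero_less_divide_iff)
    qed
    finally show ?thesis .
  qed
  have c_summable: "summable c"
    unfolding c_def by (intro summable_mult summable_geometric) simp
  have summable: "summable (\<lambda>k. prob (\<Union>j<2 ^ k. E k j))"
    using level by (intro summable_comparison_test'[OF c_summable]) auto
  have "prob (large_dyadic_increment M B e T) = prob (\<Union>k. \<Union>j<2 ^ k. E k j)"
    by (simp add: large_dyadic_increment_def E_def)
  also have "\<dots> \<le> (\<Sum>k. prob (\<Union>j<2 ^ k. E k j))"
    using summable by (intro finite_measure_subadditive_countably) auto
  also have "\<dots> \<le> (\<Sum>k. c k)"
    by (intro suminf_le level summable c_summable)
  also have "\<dots> = 3 / (e ^ 4 * T\<^sup>2) * (2401 / 353)"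
    unfolding c_def by (subst suminf_mult) (auto simp: suminf_geometric summable_geometric)
  finally show ?thesis .
qed

text \<open>The factor \<open>1 / T\<^sup>2\<close> in the union bound is \<open>(1 / 4) ^ m\<close> for \<open>T = 2 ^ m\<close>, so Borel-Cantelli
  applies.\<close>

lemma AE_eventually_no_large_dyadic_increment:
  assumes e: "0 < e"
  shows "AE \<omega> in M. eventually (\<lambda>m. \<omega> \<notin> large_dyadic_increment M B e (2 ^ m)) sequentially"
proof -
  have majorant: "summable (\<lambda>m. 3 / e ^ 4 * (2401 / 353) * (1 / 4 :: real) ^ m)"
    by (intro summable_mult summable_geometric) simp
  have "prob (large_dyadic_increment M B e (2 ^ m))
      \<le> 3 / e ^ 4 * (2401 / 353) * (1 / 4) ^ m" for m
  proof -
    have "((2 :: real) ^ m)\<^sup>2 = 4 ^ m"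
      by (simp add: power_mult[symmetric] mult.commute[of m] power_mult)
    then show ?thesis
      using prob_large_dyadic_increment[of "2 ^ m" e] e by (simp add: power_one_over)
  qed
  then have "summable (\<lambda>m. prob (large_dyadic_increment M B e (2 ^ m)))"
    by (intro summable_comparison_test'[OF majorant]) simp
  then have "AE \<omega> in M. eventually
      (\<lambda>m. \<omega> \<in> space M - large_dyadic_increment M B e (2 ^ m)) sequentially"
    by (intro borel_cantelli_AE1) (auto simp: emeasure_eq_measure)
  then show ?thesis by (auto elim!: eventually_mono)
qed

text \<open>The constant \<open>8\<close> is the sum of the geometric series with ratio \<open>7 / 8\<close>.\<close>

lemma path_bound_if_no_large_dyadic_increment:
  assumes \<omega>: "\<omega> \<in> space M" "\<omega> \<notin> large_dyadic_increment M B e T"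
    and T: "0 < T" and e: "0 < e"
    and zero: "B 0 \<omega> = 0" and cont: "continuous_on {0..} (\<lambda>t. B t \<omega>)"
    and s: "s \<in> {0..T}"
  shows "\<bar>B s \<omega>\<bar> \<le> 8 * e * T"
proof (rule chaining_bound[where f = "\<lambda>s. B s \<omega>" and a = "\<lambda>k. e * (7 / 8) ^ k * T"])
  show "continuous_on {0..T} (\<lambda>s. B s \<omega>)"
    using cont by (rule continuous_on_subset) auto
  show "\<bar>B (real (Suc j) * T / 2 ^ k) \<omega> - B (real j * T / 2 ^ k) \<omega>\<bar> \<le> e * (7 / 8) ^ k * T"
    if "j < 2 ^ k" for k j
    using \<omega> that unfolding large_dyadic_increment_def by (force simp del: of_nat_Suc)
  show "(\<Sum>i\<le>k. e * (7 / 8) ^ i * T) \<le> 8 * e * T" for k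
  proof -
    have "(\<Sum>i\<le>k. (7 / 8 :: real) ^ i) = 8 - 7 * (7 / 8) ^ k"
      by (induction k) simp_all
    then have "(\<Sum>i\<le>k. (7 / 8 :: real) ^ i) \<le> 8" by simp
    then have "e * T * (\<Sum>i\<le>k. (7 / 8) ^ i) \<le> e * T * 8"
      using e T by (intro mult_left_mono) auto
    then show ?thesis by (simp add: sum_distrib_left mult_ac)
  qed
qed (use T zero s in auto)

text \<open>Only the countably many tolerances \<open>1 / Suc p\<close> are used, so that a single null set serves for
  all of them.\<close>

lemma AE_path_sublinear_along_powers:
  "AE \<omega> in M. \<forall>e>0. eventually (\<lambda>m. \<forall>s\<in>{0..2 ^ m}. \<bar>B s \<omega>\<bar> \<le> e * 2 ^ m) sequentially"
proof -
  have "AE \<omega> in M. \<forall>p. eventually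
      (\<lambda>m. \<omega> \<notin> large_dyadic_increment M B (1 / real (Suc p)) (2 ^ m)) sequentially"
    unfolding AE_all_countable by (intro allI AE_eventually_no_large_dyadic_increment) simp
  then show ?thesis
    using start_at_zero continuous_paths AE_space
  proof eventually_elim
    case (elim \<omega>)
    show ?case
    proof (intro allI impI)
      fix e :: real
      assume "0 < e"
      then obtain p where p: "1 / real (Suc p) < e / 8"
        using nat_approx_posE[of "e / 8"] by auto
      have "eventually (\<lambda>m. \<omega> \<notin> large_dyadic_increment M B (1 / real (Suc p)) (2 ^ m)) sequentially"
        using elim(1) by blast
      then show "eventually (\<lambda>m. \<forall>s\<in>{0..2 ^ m}. \<bar>B s \<omega>\<bar> \<le> e * 2 ^ m) sequentially"
      proof (rule eventually_mono, intro ballI)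
        fix m :: nat and s :: real
        assume m: "\<omega> \<notin> large_dyadic_increment M B (1 / real (Suc p)) (2 ^ m)"
          and s: "s \<in> {0..2 ^ m}"
        have "\<bar>B s \<omega>\<bar> \<le> 8 * (1 / real (Suc p)) * 2 ^ m"
          using elim by (intro path_bound_if_no_large_dyadic_increment[OF _ m _ _ _ _ s]) auto
        also have "\<dots> \<le> e * 2 ^ m"
          using p by (intro mult_right_mono) auto
        finally show "\<bar>B s \<omega>\<bar> \<le> e * 2 ^ m" .
      qed
    qed
  qed
qed

end

section \<open>The range of a path close to a straight line\<close>

text \<open>The function \<open>\<lambda>s. \<eta> * s\<close> attains its maximum and its minimum over \<open>{0..t}\<close> at the end points,
  where they are \<open>max 0 (\<eta> * t)\<close> and \<open>min 0 (\<eta> * t)\<close>; their difference is \<open>\<bar>\<eta>\<bar> * t\<close>, whatever the sign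
  of \<open>\<eta>\<close>.\<close>

lemma process_range_near_linear:
  assumes t: "0 \<le> t" and d: "\<And>s. s \<in> {0..t} \<Longrightarrow> \<bar>B s \<omega>\<bar> \<le> d"
  shows "\<bar>process_range (with_drift B \<eta>) t \<omega> - \<bar>\<eta>\<bar> * t\<bar> \<le> 2 * d"
proof -
  let ?V = "\<lambda>s. with_drift B \<eta> s \<omega>"
  have line: "min 0 (\<eta> * t) \<le> \<eta> * s" "\<eta> * s \<le> max 0 (\<eta> * t)" if s: "s \<in> {0..t}" for s
  proof -
    have "\<eta> * s \<le> \<eta> * t \<and> 0 \<le> \<eta> * s" if "0 \<le> \<eta>"
      using that s by (auto intro: mult_left_mono)
    moreover have "\<eta> * t \<le> \<eta> * s \<and> \<eta> * s \<le> 0" if "\<eta> \<le> 0"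
      using that s by (auto intro: mult_left_mono_neg simp: mult_nonpos_nonneg)
    ultimately show "min 0 (\<eta> * t) \<le> \<eta> * s" "\<eta> * s \<le> max 0 (\<eta> * t)"
      by linarith+
  qed
  have upper: "?V s \<le> max 0 (\<eta> * t) + d" if "s \<in> {0..t}" for s
    using line(2)[OF that] d[OF that] unfolding with_drift_def by linarith
  have lower: "min 0 (\<eta> * t) - d \<le> ?V s" if "s \<in> {0..t}" for s
    using line(1)[OF that] d[OF that] unfolding with_drift_def by linarith
  have bdd: "bdd_above (?V ` {0..t})" "bdd_below (?V ` {0..t})"
    by (rule bdd_aboveI2[OF upper] bdd_belowI2[OF lower], assumption)+
  have sup_le: "(SUP s\<in>{0..t}. ?V s) \<le> max 0 (\<eta> * t) + d"
    using t upper by (intro cSUP_least) auto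
  have inf_ge: "min 0 (\<eta> * t) - d \<le> (INF s\<in>{0..t}. ?V s)"
    using t lower by (intro cINF_greatest) auto
  have ends: "\<bar>?V 0\<bar> \<le> d" "\<bar>?V t - \<eta> * t\<bar> \<le> d"
    using t d[of 0] d[of t] by (auto simp: with_drift_def)
  have "?V 0 \<le> (SUP s\<in>{0..t}. ?V s)" "?V t \<le> (SUP s\<in>{0..t}. ?V s)"
    using t bdd by (auto intro: cSUP_upper)
  with ends have sup_ge: "max 0 (\<eta> * t) - d \<le> (SUP s\<in>{0..t}. ?V s)" by linarith
  have "(INF s\<in>{0..t}. ?V s) \<le> ?V 0" "(INF s\<in>{0..t}. ?V s) \<le> ?V t"
    using t bdd by (auto intro: cINF_lower)
  with ends have inf_le: "(INF s\<in>{0..t}. ?V s) \<le> min 0 (\<eta> * t) + d" by linarith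
  have "\<bar>\<eta>\<bar> * t = \<bar>\<eta> * t\<bar>" using t by (simp add: abs_mult)
  then have "\<bar>\<eta>\<bar> * t = max 0 (\<eta> * t) - min 0 (\<eta> * t)" by linarith
  then show ?thesis
    using sup_le sup_ge inf_le inf_ge unfolding process_range_def by linarith
qed

lemma power_two_bracket:
  fixes t :: real
  assumes t: "2 ^ N < t"
  obtains m where "N \<le> m" "t \<le> 2 ^ m" "2 ^ m \<le> 2 * t"
proof -
  define m where "m = (LEAST m. t \<le> 2 ^ m)"
  obtain n where "t < 2 ^ n" using real_arch_pow[of 2 t] by auto
  then have "t \<le> 2 ^ n" by simp
  then have m: "t \<le> 2 ^ m" unfolding m_def by (rule LeastI)
  with t have "(2 :: real) ^ N < 2 ^ m" by (rule less_le_trans)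
  then have less: "N < m" by (rule power_less_imp_less_exp[rotated]) simp
  then obtain l where l: "m = Suc l" by (cases m) auto
  have "\<not> t \<le> 2 ^ l" using not_less_Least[of l "\<lambda>m. t \<le> 2 ^ m"] l unfolding m_def by simp
  then have "2 ^ m \<le> 2 * t" by (simp add: l)
  with less m show thesis by (intro that[of m]) simp_all
qed

lemma process_range_rate_if_sublinear:
  assumes sub: "\<And>e. 0 < e \<Longrightarrow>
    eventually (\<lambda>m. \<forall>s\<in>{0..2 ^ m}. \<bar>B s \<omega>\<bar> \<le> e * 2 ^ m) sequentially"
  shows "((\<lambda>t. process_range (with_drift B \<eta>) t \<omega> / t) \<longlongrightarrow> \<bar>\<eta>\<bar>) at_top"
proof (rule tendstoI)
  fix e :: real
  assume e: "0 < e"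
  (* One factor 2 is lost in passing from 2 ^ m to t and one in comparing ranges;
     the rest gives strictness. *)
  obtain N where N: "\<And>m s. N \<le> m \<Longrightarrow> s \<in> {0..2 ^ m} \<Longrightarrow> \<bar>B s \<omega>\<bar> \<le> e / 8 * 2 ^ m"
  proof -
    have "0 < e / 8" using e by simp
    from sub[OF this] show thesis
      unfolding eventually_sequentially using that by blast
  qed
  show "eventually (\<lambda>t. dist (process_range (with_drift B \<eta>) t \<omega> / t) \<bar>\<eta>\<bar> < e) at_top"
    using eventually_gt_at_top[of "2 ^ N"]
  proof eventually_elim
    case (elim t)
    have t: "0 < t" using elim by (rule le_less_trans[rotated]) simp
    obtain m where m: "N \<le> m" "t \<le> 2 ^ m" "2 ^ m \<le> 2 * t"
      using power_two_bracket[OF elim] .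
    have "\<bar>B s \<omega>\<bar> \<le> e / 4 * t" if "s \<in> {0..t}" for s
    proof -
      have "\<bar>B s \<omega>\<bar> \<le> e / 8 * 2 ^ m" using N[of m s] m that by auto
      also have "\<dots> \<le> e / 8 * (2 * t)" using m e by (intro mult_left_mono) auto
      finally show ?thesis by simp
    qed
    then have "\<bar>process_range (with_drift B \<eta>) t \<omega> - \<bar>\<eta>\<bar> * t\<bar> \<le> 2 * (e / 4 * t)"
      using t by (intro process_range_near_linear) auto
    also have "\<dots> < e * t" using e t by simp
    finally have "\<bar>process_range (with_drift B \<eta>) t \<omega> - \<bar>\<eta>\<bar> * t\<bar> / t < e"
      using t by (simp add: pos_divide_less_eq)
    moreover have "process_range (with_drift B \<eta>) t \<omega> / t - \<bar>\<eta>\<bar>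
        = (process_range (with_drift B \<eta>) t \<omega> - \<bar>\<eta>\<bar> * t) / t"
      using t by (simp add: field_simps)
    ultimately show ?case using t by (simp add: dist_real_def abs_divide)
  qed
qed

theorem corollary4:
  fixes M :: "'a measure" and B :: "real \<Rightarrow> 'a \<Rightarrow> real" and \<eta> :: real
  assumes "standard_brownian_motion M B"
  shows "AE \<omega> in M. ((\<lambda>t. process_range (with_drift B \<eta>) t \<omega> / t) \<longlongrightarrow> \<bar>\<eta>\<bar>) at_top"
proof -
  interpret standard_brownian_motion M B by fact
  show ?thesis
    using AE_path_sublinear_along_powers
    by eventually_elim (rule process_range_rate_if_sublinear, blast)
qed

end
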